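(* Let $t\geq 2$ be an integer and let $A$ be a column-$t$-partite zero-one matrix. Then $\operatorname{ex}(n,A)=O(n^{2-\frac{1}{t}})$ as $n\to\infty$, where the implied constant may depend on $t$ and $A$ but not on $n$.
   Context: A zero-one matrix is a (finite) matrix all of whose entries are $0$ or $1$. For zero-one matrices $A$ and $M$, we say that $M$ contains $A$ if, by deleting some (possibly no) rows and columns from $M$, and possibly turning some of its $1$-entries into $0$-entries, we can obtain $A$ (the order of the remaining rows and columns is kept). The weight of a zero-one matrix is the number of its $1$-entries. The extremal number $\operatorname{ex}(n,A)$ of a zero-one matrix $A$ is the maximum possible weight of an $n\times n$ zero-one matrix that does not contain $A$. A zero-one matrix $A$ is column-$t$-partite if it can be cut along its columns (i.e. by vertical cuts, so that each piece consists of consecutive columns of $A$ with all rows kept) into $t$ submatrices such that every row of each of these submatrices contains at most one $1$-entry. *)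

theory Defs
  imports
    "HOL-Library.Landau_Symbols"
    "Jordan_Normal_Form.DL_Submatrix"
begin

definition zero_one_mat :: "nat mat \<Rightarrow> bool" where
  "zero_one_mat A \<longleftrightarrow> elements_mat A \<subseteq> {0, 1}"

(* I and J are the rows and columns of M that are kept. Among zero-one matrices,
   \<le> (equal dimensions, entrywise order) expresses that 1-entries may be turned into 0-entries. *)
definition mat_contains :: "nat mat \<Rightarrow> nat mat \<Rightarrow> bool" where
  "mat_contains M A \<longleftrightarrow>
     (\<exists>I J. I \<subseteq> {..<dim_row M} \<and> J \<subseteq> {..<dim_col M} \<and> A \<le> submatrix M I J)"

definition mat_weight :: "nat mat \<Rightarrow> nat" where
  "mat_weight M = card {(i, j). i < dim_row M \<and> j < dim_col M \<and> M $$ (i, j) = 1}"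

(* The set of weights is finite, so Sup is its maximum. It is empty exactly when every n-by-n
   zero-one matrix contains A (A has no 1-entry and fits into an n-by-n matrix);
   in that case the value is 0, the supremum of the empty set of naturals. *)
definition mat_ex :: "nat \<Rightarrow> nat mat \<Rightarrow> nat" where
  "mat_ex n A =
     Sup (mat_weight ` {M \<in> carrier_mat n n. zero_one_mat M \<and> \<not> mat_contains M A})"

(* Piece k consists of the columns c k, ..., c (k + 1) - 1 (counted from 0); pieces may be empty,
   so t may exceed the number of columns. *)
definition column_partite :: "nat \<Rightarrow> nat mat \<Rightarrow> bool" where
  "column_partite t A \<longleftrightarrow>
     (\<exists>c :: nat \<Rightarrow> nat. c 0 = 0 \<and> c t = dim_col A \<and> mono_on {..t} c \<and>
       (\<forall>k<t. let B = submatrix A UNIV {c k..<c (Suc k)}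
              in \<forall>i<dim_row B. card {j. j < dim_col B \<and> B $$ (i, j) = 1} \<le> 1))"

end

theory Submission
  imports Defs "HOL-Real_Asymp.Real_Asymp"
begin

text \<open>
  Organise the \<open>n\<close> rows as the leaves of a \<open>p\<close>-ary tree of constant depth \<open>h\<close>, so \<open>p\<close> is about
  \<open>n powr (1 / h)\<close>. For a \<open>t\<close>-set \<open>T\<close> of columns call a row with ones in all of \<open>T\<close> bad for \<open>T\<close>
  if none of its ancestors has at least \<open>m\<close> children containing such a row; each \<open>T\<close> has at most
  \<open>m ^ h\<close> bad rows. If the weight is at least \<open>C * n powr (2 - 1 / t)\<close> with \<open>C\<close> large, convexity
  yields a row with \<open>d \<ge> n powr (1 - 1 / t)\<close> ones which is good for at least half of its \<open>t\<close>-sets.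
  Colour each of these by the level of a suitable ancestor and \<open>m\<close> of its children. Only \<open>h * p ^ m\<close>
  colours occur, which for \<open>t \<ge> 2\<close> and large \<open>h\<close> is an arbitrarily small power of \<open>d\<close>, so by
  Erdos's theorem on complete \<open>t\<close>-partite hypergraphs some colour class contains all transversals of
  column sets \<open>U\<^sub>1 < \<dots> < U\<^sub>t\<close>. All these transversals occur in the same \<open>m\<close> disjoint row intervals,
  so the rows of a column-\<open>t\<close>-partite matrix can be embedded one by one in these intervals.
\<close>

section \<open>Erdos's theorem on complete t-partite hypergraphs\<close>

text \<open>Induction on \<open>t\<close>, splitting off the first coordinate: many tails have many
  extensions, so double counting gives a \<open>k\<close>-set \<open>U\<close> whose elements all
  extend many common tails, and the induction hypothesis applies to those tails. Edges are arbitrary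
  lists and the parts may overlap; order is imposed only later, through
  \<open>inc_lists\<close>.\<close>

lemma exists_box:
  assumes "k \<ge> 1"
  shows "\<exists>\<gamma>>0. \<gamma> \<le> 1 \<and> (\<exists>d0. \<forall>X :: 'a set. \<forall>E. finite X \<longrightarrow> d0 \<le> card X \<longrightarrow>
           E \<subseteq> {xs. length xs = t \<and> set xs \<subseteq> X} \<longrightarrow>
           real (card X) powr (real t - \<gamma>) \<le> real (card E) \<longrightarrow>
           (\<exists>Us. length Us = t \<and> (\<forall>U\<in>set Us. U \<subseteq> X \<and> card U = k) \<and> {xs. list_all2 (\<in>) xs Us} \<subseteq> E))"
proof (induction t)
  case 0
  have "(\<exists>Us. length Us = 0 \<and> (\<forall>U\<in>set Us. U \<subseteq> X \<and> card U = k) \<and> {xs. list_all2 (\<in>) xs Us} \<subseteq> E)"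
    if "finite X" "1 \<le> card X" "E \<subseteq> {xs. length xs = 0 \<and> set xs \<subseteq> X}" 
       "real (card X) powr (real 0 - 1) \<le> real (card E)" for X :: "'a set" and E
  proof -
    have "real (card E) > 0" using that(2,4)
      by (smt (verit) of_nat_0_less_iff of_nat_le_iff of_nat_1 powr_gt_zero)
    then have "E \<noteq> {}" by auto
    then have "[] \<in> E" using that(3) by auto
    then show ?thesis by (intro exI[of _ "[]"]) auto
  qed
  then show ?case by (intro exI[of _ 1]) (auto intro!: exI[of _ 1])
next
  case (Suc t)
  then obtain \<gamma>' d0' where \<gamma>': "\<gamma>' > 0" "\<gamma>' \<le> 1"
    and IH: "\<And>X :: 'a set. \<And>E. finite X \<Longrightarrow> d0' \<le> card X \<Longrightarrow>
           E \<subseteq> {xs. length xs = t \<and> set xs \<subseteq> X} \<Longrightarrow>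
           real (card X) powr (real t - \<gamma>') \<le> real (card E) \<Longrightarrow>
           (\<exists>Us. length Us = t \<and> (\<forall>U\<in>set Us. U \<subseteq> X \<and> card U = k) \<and> {xs. list_all2 (\<in>) xs Us} \<subseteq> E)"
    by meson
  \<comment> \<open>The loss in the exponent is split into \<open>k + 2\<close> shares: one for
    passing to rich tails, \<open>k\<close> for choosing a \<open>k\<close>-set of extensions, one
    to absorb constants.\<close>
  define \<gamma> where "\<gamma> = \<gamma>' / (real k + 2)"
  have \<gamma>'_eq: "\<gamma>' = \<gamma> * (real k + 1) + \<gamma>"
  proof -
    have "\<gamma>' = \<gamma> * (real k + 2)" by (simp add: \<gamma>_def)
    then show ?thesis by (simp add: algebra_simps)
  qed
  have \<gamma>: "\<gamma> > 0" "\<gamma> \<le> 1/2"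
    using \<gamma>' by (auto simp: \<gamma>_def field_simps)
  \<comment> \<open>This threshold absorbs the constants of the averaging; the next one gives
    \<open>e \<ge> k\<close>, so that rich tails have \<open>k\<close> extensions.\<close>
  have "eventually (\<lambda>d. real d powr \<gamma> \<ge> 2 * (2 * real k) ^ k) at_top"
    using \<gamma>(1) by real_asymp
  moreover have "eventually (\<lambda>d. real d powr (1 - \<gamma>) \<ge> 2 * real k) at_top"
  proof -
    have "1 - \<gamma> > 0" using \<gamma> by simp
    then show ?thesis by real_asymp
  qed
  moreover have "eventually (\<lambda>d::nat. d \<ge> 1 \<and> d \<ge> d0') at_top"
    by (intro eventually_conj eventually_ge_at_top)
  ultimately have "eventually (\<lambda>d. real d powr \<gamma> \<ge> 2 * (2 * real k) ^ k \<and> real d powr (1 - \<gamma>) \<ge> 2 * real k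
       \<and> d \<ge> 1 \<and> d \<ge> d0') at_top"
    by eventually_elim auto
  then obtain d0 where d0: "\<And>d. d \<ge> d0 \<Longrightarrow> real d powr \<gamma> \<ge> 2 * (2 * real k) ^ k \<and> real d powr (1 - \<gamma>) \<ge> 2 * real k
       \<and> d \<ge> 1 \<and> d \<ge> d0'"
    by (auto simp: eventually_at_top_linorder)
  have "(\<exists>Us. length Us = Suc t \<and> (\<forall>U\<in>set Us. U \<subseteq> X \<and> card U = k) \<and> {xs. list_all2 (\<in>) xs Us} \<subseteq> E)"
    if X: "finite X" "d0 \<le> card X" and E: "E \<subseteq> {xs. length xs = Suc t \<and> set xs \<subseteq> X}"
       and cE: "real (card X) powr (real (Suc t) - \<gamma>) \<le> real (card E)" for X :: "'a set" and E
  proof -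
    define d where "d = card X"
    note d = d0[OF X(2), folded d_def]
    have dpos: "real d > 0" using d by simp
    \<comment> \<open>Half of the average degree that the size of \<open>E\<close> forces: tails
      below it account for at most half of the lower bound on \<open>card E\<close>, which leaves
      many rich tails \<open>Y\<close>.\<close>
    define e where "e = real d powr (1 - \<gamma>) / 2"
    have e: "e \<ge> real k" using d by (simp add: e_def)
    define Z where "Z = {ys. length ys = t \<and> set ys \<subseteq> X}"
    have finZ: "finite Z" and cZ: "card Z = d ^ t"
      unfolding Z_def using finite_lists_length_eq[OF X(1), of t] card_lists_length_eq[OF X(1), of t]
      by (auto simp: d_def conj_commute)
    define F where "F ys = {x \<in> X. x # ys \<in> E}" for ys
    have finF: "finite (F ys)" and cF: "card (F ys) \<le> d" for ys
      using X(1) by (auto simp: F_def d_def intro: card_mono)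
    define Y where "Y = {ys \<in> Z. e \<le> real (card (F ys))}"
    have finY: "finite Y" using finZ by (simp add: Y_def)
    have "E = (\<lambda>(ys, x). x # ys) ` Sigma Z F"
    proof
      show "E \<subseteq> (\<lambda>(ys, x). x # ys) ` Sigma Z F"
      proof
        fix xs assume xs: "xs \<in> E"
        then have "length xs = Suc t" "set xs \<subseteq> X" using E by auto
        then obtain x ys where "xs = x # ys" by (cases xs) auto
        then show "xs \<in> (\<lambda>(ys, x). x # ys) ` Sigma Z F"
          using xs \<open>length xs = Suc t\<close> \<open>set xs \<subseteq> X\<close>
          by (intro image_eqI[of _ _ "(ys, x)"]) (auto simp: F_def Z_def)
      qed
    qed (auto simp: F_def)
    then have "card E = card (Sigma Z F)"
      by (simp add: card_image inj_on_def split: prod.splits)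
    also have "\<dots> = (\<Sum>ys\<in>Z. card (F ys))" using finZ finF by simp
    finally have "real (card E) = (\<Sum>ys\<in>Z. real (card (F ys)))" by simp
    also have "\<dots> \<le> (\<Sum>ys\<in>Z. (if ys \<in> Y then real d else 0) + e)"
    proof (rule sum_mono)
      fix ys assume "ys \<in> Z"
      moreover have "e \<ge> 0" using e by linarith
      ultimately show "real (card (F ys)) \<le> (if ys \<in> Y then real d else 0) + e"
        using cF[of ys] by (auto simp: Y_def)
    qed
    also have "\<dots> = real (card Y) * real d + real d ^ t * e"
      using finZ cZ by (simp add: sum.distrib sum.If_cases Y_def Int_def)
    finally have 1: "real (card E) \<le> real (card Y) * real d + real d ^ t * e" .
    have "real d ^ t * e = real d powr (real (Suc t) - \<gamma>) / 2"
      using dpos by (simp add: e_def powr_realpow[symmetric] powr_add[symmetric] algebra_simps)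
    with 1 cE have "real d powr (real (Suc t) - \<gamma>) / 2 \<le> real (card Y) * real d"
      by (simp add: d_def)
    moreover have "real d powr (real (Suc t) - \<gamma>) = real d powr (real t - \<gamma>) * real d"
      using dpos by (simp add: powr_mult_base algebra_simps)
    ultimately have cY: "real d powr (real t - \<gamma>) / 2 \<le> real (card Y)"
      using dpos by (simp add: field_simps)
    define W where "W = {U. U \<subseteq> X \<and> card U = k}"
    have finW: "finite W" and cW: "card W = d choose k"
      using n_subsets[OF X(1), of k] X(1) by (auto simp: W_def d_def)
    define Q where "Q U = {ys \<in> Y. U \<subseteq> F ys}" for U
    \<comment> \<open>Double counting of the pairs of a rich tail and a \<open>k\<close>-set of its
      extensions.\<close>
    have "(\<Sum>U\<in>W. card (Q U)) = card (Sigma W Q)"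
      using finW finY by (simp add: Q_def)
    also have "\<dots> = card ((\<lambda>(a, b). (b, a)) ` Sigma W Q)"
      by (rule card_image[symmetric]) (auto simp: inj_on_def)
    also have "(\<lambda>(a, b). (b, a)) ` Sigma W Q = Sigma Y (\<lambda>ys. {U. U \<subseteq> F ys \<and> card U = k})"
      by (auto simp: Q_def W_def F_def image_iff)
    also have "card \<dots> = (\<Sum>ys\<in>Y. card (F ys) choose k)"
      using finY finF by (simp add: n_subsets)
    finally have QS: "real (\<Sum>U\<in>W. card (Q U)) = (\<Sum>ys\<in>Y. real (card (F ys) choose k))" by simp
    have "(\<Sum>ys\<in>Y. (e / real k) ^ k) \<le> (\<Sum>ys\<in>Y. real (card (F ys) choose k))"
    proof (rule sum_mono)
      fix ys assume "ys \<in> Y"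
      then have "e \<le> real (card (F ys))" by (simp add: Y_def)
      then have "k \<le> card (F ys)" "(e / real k) ^ k \<le> (real (card (F ys)) / real k) ^ k"
        using e by (auto intro!: power_mono divide_right_mono)
      then show "(e / real k) ^ k \<le> real (card (F ys) choose k)"
        using binomial_ge_n_over_k_pow_k[of k "card (F ys)", where 'a = real] by linarith
    qed
    then have low: "real (card Y) * (e / real k) ^ k \<le> real (\<Sum>U\<in>W. card (Q U))"
      unfolding QS by simp
    define q where "q = real d powr (real t - \<gamma>')"
    \<comment> \<open>Averaging: there are at most \<open>d ^ k\<close> sets \<open>U\<close>, so
      values below \<open>q\<close> throughout would contradict the lower bound on the number of
      pairs.\<close>
    have "\<exists>U\<in>W. q \<le> real (card (Q U))"
    proof (rule ccontr)
      assume "\<not> ?thesis"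
      then have *: "\<And>U. U \<in> W \<Longrightarrow> real (card (Q U)) < q" by force
      have qpos: "q > 0" using dpos by (simp add: q_def)
      have kd: "k \<le> d"
      proof -
        have "real k \<le> e" by (rule e)
        also have "\<dots> \<le> real d powr (1 - \<gamma>)" by (simp add: e_def)
        also have "\<dots> \<le> real d powr 1" using \<gamma> d by (intro powr_mono) auto
        finally show ?thesis using dpos by simp
      qed
      then have "card W > 0" by (simp add: cW)
      then have Wne: "W \<noteq> {}" by auto
      have "real (\<Sum>U\<in>W. card (Q U)) < (\<Sum>U\<in>W. q)"
        unfolding of_nat_sum by (rule sum_strict_mono[OF finW Wne]) (rule *)
      also have "\<dots> = real (d choose k) * q" by (simp add: cW)
      also have "\<dots> \<le> real d ^ k * q"
        using binomial_le_pow[OF kd] qpos by (intro mult_right_mono) (auto simp flip: of_nat_power)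
      finally have "real (card Y) * (e / real k) ^ k < real d ^ k * q" using low by linarith
      moreover have "real d powr (real t - \<gamma>) / 2 * (e / real k) ^ k \<le> real (card Y) * (e / real k) ^ k"
        using e cY by (intro mult_right_mono) (auto intro!: zero_le_power divide_nonneg_nonneg simp: e_def)
      ultimately have lt: "real d powr (real t - \<gamma>) / 2 * (e / real k) ^ k < real d ^ k * q" by linarith
      define g where "g = (2 * real k) ^ k"
      have gpos: "g > 0" using assms by (simp add: g_def)
      have "(e / real k) ^ k = real d powr ((1 - \<gamma>) * real k) / g"
        using dpos by (simp add: g_def e_def power_divide power_mult_distrib powr_powr[symmetric] powr_realpow)
      with lt have "real d powr (real t - \<gamma>) / 2 * (real d powr ((1 - \<gamma>) * real k) / g) < real d powr real k * q"
        using dpos by (simp add: powr_realpow)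
      with gpos have "real d powr (real t - \<gamma>) * real d powr ((1 - \<gamma>) * real k) < real d powr real k * q * (2 * g)"
        by (simp add: field_simps)
      also have "\<dots> \<le> real d powr real k * q * real d powr \<gamma>"
        using d qpos by (intro mult_left_mono) (auto simp: g_def)
      also have "\<dots> = real d powr (real k + (real t - \<gamma>') + \<gamma>)"
        by (simp add: q_def powr_add)
      also have "real k + (real t - \<gamma>') + \<gamma> = (real t - \<gamma>) + (1 - \<gamma>) * real k"
        by (simp add: \<gamma>'_eq algebra_simps)
      finally show False by (simp add: powr_add)
    qed
    then obtain U where U: "U \<in> W" "q \<le> real (card (Q U))" by blast
    have "Q U \<subseteq> {xs. length xs = t \<and> set xs \<subseteq> X}"
      by (auto simp: Q_def Y_def Z_def)
    from IH[OF X(1) _ this] U d obtain Us where Us: "length Us = t" "\<forall>U\<in>set Us. U \<subseteq> X \<and> card U = k"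
      "{xs. list_all2 (\<in>) xs Us} \<subseteq> Q U"
      by (auto simp: q_def d_def)
    show ?thesis
    proof (intro exI conjI)
      show "{xs. list_all2 (\<in>) xs (U # Us)} \<subseteq> E"
        using Us(3) by (auto simp: list_all2_Cons2 Q_def F_def)
    qed (use Us U in \<open>auto simp: W_def\<close>)
  qed
  then show ?case using \<gamma> by (intro exI[of _ \<gamma>]) (auto intro!: exI[of _ d0])
qed

section \<open>Bad rows in a p-ary tree\<close>

text \<open>
  The node of level \<open>l\<close> above row \<open>s\<close> is \<open>s div p ^ l\<close>; \<open>children p l S r\<close> are those children of the
  level \<open>l + 1\<close> ancestor of \<open>r\<close> that have a descendant in \<open>S\<close>.
\<close>
definition children :: "nat \<Rightarrow> nat \<Rightarrow> nat set \<Rightarrow> nat \<Rightarrow> nat set" where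
  "children p l S r = (\<lambda>s. s div p ^ l) ` {s \<in> S. s div p ^ Suc l = r div p ^ Suc l}"

text \<open>Induction on the height of the root \<open>q\<close>. If a bad row exists, fewer than
  \<open>m\<close> children of the root meet \<open>S\<close>, and a row bad for \<open>S\<close> is
  also bad within the subtree of its own child; so each level costs at most a factor
  \<open>m\<close>.\<close>

lemma card_nonbranching_le:
  assumes "finite S" "\<And>s. s \<in> S \<Longrightarrow> s div p ^ h = q"
  shows "card {r \<in> S. \<forall>l<h. card (children p l S r) < m} \<le> m ^ h"
  using assms
proof (induction h arbitrary: S q)
  case 0
  then have "S \<subseteq> {q}" by auto
  then have "card S \<le> 1" using card_mono[of "{q}" S] by simp
  then show ?case by simp
next
  case (Suc h)
  define bad where "bad = {r \<in> S. \<forall>l<Suc h. card (children p l S r) < m}"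
  define V where "V = (\<lambda>s. s div p ^ h) ` S"
  define S' where "S' v = {s \<in> S. s div p ^ h = v}" for v
  define bad' where "bad' v = {r \<in> S' v. \<forall>l<h. card (children p l (S' v) r) < m}" for v
  have IH: "card (bad' v) \<le> m ^ h" for v
    unfolding bad'_def using Suc.prems(1) by (intro Suc.IH[where q = v]) (auto simp: S'_def)
  \<comment> \<open>Rows with a common ancestor at level \<open>l + 1 \<le> h\<close> share their
    level \<open>h\<close> ancestor, so restricting \<open>S\<close> to one subtree leaves the lower
    \<open>children\<close> sets unchanged.\<close>
  have refine: "s div p ^ h = r div p ^ h" if "s div p ^ Suc l = r div p ^ Suc l" "l < h" for s r l
  proof -
    have "p ^ h = p ^ Suc l * p ^ (h - Suc l)" using that(2) by (metis power_add Suc_leI le_add_diff_inverse)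
    then show ?thesis by (simp only: div_mult2_eq that(1))
  qed
  have sub: "bad \<subseteq> (\<Union>v\<in>V. bad' v)"
  proof
    fix r assume r: "r \<in> bad"
    have "children p l (S' (r div p ^ h)) r = children p l S r" if "l < h" for l
    proof -
      have "{s \<in> S' (r div p ^ h). s div p ^ Suc l = r div p ^ Suc l} = {s \<in> S. s div p ^ Suc l = r div p ^ Suc l}"
        unfolding S'_def using refine that by blast
      then show ?thesis by (simp only: children_def)
    qed
    then have "r \<in> bad' (r div p ^ h)" using r by (auto simp: bad_def bad'_def S'_def)
    moreover have "r div p ^ h \<in> V" using r by (auto simp: V_def bad_def)
    ultimately show "r \<in> (\<Union>v\<in>V. bad' v)" by blast
  qed
  show ?case unfolding bad_def[symmetric]
  proof (cases "bad = {}")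
    case False
    then obtain r where r: "r \<in> bad" by blast
    then have "r \<in> S" by (simp add: bad_def)
    then have "{s \<in> S. s div p ^ Suc h = r div p ^ Suc h} = S" using Suc.prems(2) by blast
    then have "children p h S r = V" by (simp only: children_def V_def)
    then have cV: "card V \<le> m" using r by (auto simp: bad_def)
    have finV: "finite V" using Suc.prems(1) by (simp add: V_def)
    have "card bad \<le> card (\<Union>v\<in>V. bad' v)"
      using Suc.prems(1) finV by (intro card_mono sub) (auto simp: bad'_def S'_def)
    also have "\<dots> \<le> (\<Sum>v\<in>V. card (bad' v))" by (rule card_UN_le[OF finV])
    also have "\<dots> \<le> card V * m ^ h" using sum_bounded_above[of V "\<lambda>v. card (bad' v)" "m ^ h"] IH by simp
    also have "\<dots> \<le> m ^ Suc h" using cV by simp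
    finally show "card bad \<le> m ^ Suc h" .
  qed simp
qed

section \<open>A heavy row that is good for half of its t-sets\<close>

text \<open>The \<open>t\<close>-subsets of \<open>X\<close>, coded as increasing lists so that they
  can serve as edges for \<open>exists_box\<close> and fix the order of the parts it
  returns.\<close>

definition inc_lists :: "nat \<Rightarrow> nat set \<Rightarrow> nat list set" where
  "inc_lists t X = {T. sorted_wrt (<) T \<and> set T \<subseteq> X \<and> length T = t}"

lemma
  assumes "finite X"
  shows finite_inc_lists: "finite (inc_lists t X)"
    and card_inc_lists: "card (inc_lists t X) = card X choose t"
proof -
  have eq: "inc_lists t X = sorted_list_of_set ` {Y. Y \<subseteq> X \<and> card Y = t}"
  proof (intro equalityI subsetI)
    fix T assume "T \<in> inc_lists t X"
    then show "T \<in> sorted_list_of_set ` {Y. Y \<subseteq> X \<and> card Y = t}"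
      by (intro image_eqI[of _ _ "set T"])
        (auto simp: inc_lists_def strict_sorted_iff distinct_card sorted_list_of_set.idem_if_sorted_distinct)
  next
    fix T assume "T \<in> sorted_list_of_set ` {Y. Y \<subseteq> X \<and> card Y = t}"
    then obtain Y where "Y \<subseteq> X" "card Y = t" "T = sorted_list_of_set Y" by auto
    then show "T \<in> inc_lists t X" using finite_subset[OF _ assms, of Y]
      by (auto simp: inc_lists_def)
  qed
  have "finite {Y. Y \<subseteq> X \<and> card Y = t}" using assms by simp
  then show "finite (inc_lists t X)" by (simp add: eq)
  have "inj_on sorted_list_of_set {Y. Y \<subseteq> X \<and> card Y = t}"
    using assms by (auto intro!: inj_onI dest: finite_subset sorted_list_of_set_inject)
  then show "card (inc_lists t X) = card X choose t"
    by (simp add: eq card_image n_subsets[OF assms])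
qed

text \<open>Counts the pairs of a row with at least \<open>c * x\<close> ones and a
  \<open>t\<close>-set of its ones that fails \<open>P\<close>. Each \<open>t\<close>-set fails for
  at most \<open>B\<close> rows, which allows at most \<open>B * n ^ t\<close> pairs; if every such
  row failed on at least half of its sets, there would be more.\<close>

lemma exists_rich_row:
  fixes N :: "nat \<Rightarrow> nat set" and c :: real and n t B :: nat
  assumes t: "t \<ge> 1" and N: "\<And>r. r < n \<Longrightarrow> N r \<subseteq> {..<n}"
    and x: "x = real n powr (1 - 1 / real t)"
    and few: "\<And>T. T \<in> inc_lists t {..<n} \<Longrightarrow> card {r \<in> {..<n}. set T \<subseteq> N r \<and> \<not> P r T} \<le> B"
    and heavy: "2 * c * real n * x < (\<Sum>r<n. real (card (N r)))"
    and c: "c > 0" "2 * real B \<le> (c / real t) ^ t" and cx: "real t \<le> c * x"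
  shows "\<exists>r<n. c * x \<le> real (card (N r)) \<and> card (N r) choose t \<le> 2 * card {T \<in> inc_lists t (N r). P r T}"
proof (rule ccontr)
  assume contra: "\<not> ?thesis"
  have n: "n > 0" using heavy by (cases n) auto
  then have xpos: "x > 0" by (simp add: x)
  \<comment> \<open>This identity is the source of the exponent: \<open>n\<close> rows with about
    \<open>x\<close> ones each have, up to constants, as many \<open>t\<close>-sets in total as the
    \<open>n\<close> columns.\<close>
  have xt: "real n * x ^ t = real n ^ t"
  proof -
    have "x ^ t = real n powr ((1 - 1 / real t) * real t)"
      using n by (simp add: x powr_powr[symmetric] powr_realpow)
    also have "(1 - 1 / real t) * real t = real t - 1" using t by (simp add: field_simps)
    finally show ?thesis using n by (simp add: powr_mult_base powr_realpow)
  qed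
  define d where "d r = card (N r)" for r
  define R where "R = {r \<in> {..<n}. c * x \<le> real (d r)}"
  have R: "R \<subseteq> {..<n}" "finite R" by (auto simp: R_def)
  have finN: "finite (N r)" if "r < n" for r using N[OF that] finite_subset by blast
  define bad where "bad r = {T \<in> inc_lists t (N r). \<not> P r T}" for r
  have fin_bad: "finite (bad r)" if "r < n" for r
    using finite_inc_lists[OF finN[OF that]] by (simp add: bad_def)
  have half: "d r choose t \<le> 2 * card (bad r)" if "r \<in> R" for r
  proof -
    have r: "r < n" "c * x \<le> real (d r)" using that by (auto simp: R_def)
    have "inc_lists t (N r) = {T \<in> inc_lists t (N r). P r T} \<union> bad r" by (auto simp: bad_def)
    then have "card (inc_lists t (N r)) \<le> card {T \<in> inc_lists t (N r). P r T} + card (bad r)"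
      by (metis card_Un_le)
    moreover have "card (inc_lists t (N r)) = d r choose t"
      using card_inc_lists[OF finN[OF r(1)]] by (simp add: d_def)
    moreover have "2 * card {T \<in> inc_lists t (N r). P r T} < d r choose t"
      using contra r by (auto simp: d_def not_le)
    ultimately show ?thesis by linarith
  qed
  have "(\<Sum>r\<in>R. card (bad r)) = card (Sigma R bad)"
    using R fin_bad by (subst card_SigmaI) auto
  also have "\<dots> \<le> card (Sigma (inc_lists t {..<n}) (\<lambda>T. {r \<in> {..<n}. set T \<subseteq> N r \<and> \<not> P r T}))"
  proof (rule card_inj_on_le[where f = prod.swap])
    show "prod.swap ` Sigma R bad \<subseteq> Sigma (inc_lists t {..<n}) (\<lambda>T. {r \<in> {..<n}. set T \<subseteq> N r \<and> \<not> P r T})"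
      using R N by (fastforce simp: bad_def inc_lists_def)
    show "finite (Sigma (inc_lists t {..<n}) (\<lambda>T. {r \<in> {..<n}. set T \<subseteq> N r \<and> \<not> P r T}))"
      by (intro finite_SigmaI finite_inc_lists) auto
  qed auto
  also have "\<dots> = (\<Sum>T\<in>inc_lists t {..<n}. card {r \<in> {..<n}. set T \<subseteq> N r \<and> \<not> P r T})"
    by (intro card_SigmaI finite_inc_lists ballI) auto
  also have "\<dots> \<le> card (inc_lists t {..<n}) * B"
    using sum_bounded_above[of "inc_lists t {..<n}" _ B] few by simp
  also have "card (inc_lists t {..<n}) = n choose t" by (simp add: card_inc_lists)
  finally have bad_le: "(\<Sum>r\<in>R. card (bad r)) \<le> (n choose t) * B" .
  have "n choose t \<le> n ^ t" by (cases "t \<le> n") (auto simp: binomial_le_pow binomial_eq_0)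
  with bad_le have "(\<Sum>r\<in>R. card (bad r)) \<le> n ^ t * B"
    by (meson mult_le_mono1 order_trans)
  moreover have "(\<Sum>r\<in>R. d r choose t) \<le> 2 * (\<Sum>r\<in>R. card (bad r))"
    unfolding sum_distrib_left by (rule sum_mono) (rule half)
  ultimately have "(\<Sum>r\<in>R. d r choose t) \<le> 2 * (n ^ t * B)" by linarith
  then have "real (\<Sum>r\<in>R. d r choose t) \<le> real (2 * B * n ^ t)"
    by (intro of_nat_mono) (simp add: mult_ac)
  then have upper: "(\<Sum>r\<in>R. real (d r choose t)) \<le> 2 * real B * real n ^ t" by simp
  \<comment> \<open>Keeping one factor \<open>d r\<close> and bounding the other
    \<open>t - 1\<close> from below makes the estimate linear, so only the total number of ones in
    \<open>R\<close> matters; this takes the place of a convexity inequality.\<close>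
  have "real (d r) * (c * x) ^ (t - 1) / real t ^ t \<le> real (d r choose t)" if "r \<in> R" for r
  proof -
    have dr: "c * x \<le> real (d r)" using that by (simp add: R_def)
    then have "t \<le> d r" using cx by linarith
    then have "(real (d r) / real t) ^ t \<le> real (d r choose t)" by (rule binomial_ge_n_over_k_pow_k)
    moreover have "real (d r) * (c * x) ^ (t - 1) \<le> real (d r) * real (d r) ^ (t - 1)"
      using dr c xpos by (intro mult_left_mono power_mono) auto
    moreover have "real (d r) * real (d r) ^ (t - 1) = real (d r) ^ t"
      using t by (cases t) auto
    ultimately show ?thesis
      by (smt (verit) divide_right_mono of_nat_0_le_iff power_divide zero_le_power)
  qed
  then have "(\<Sum>r\<in>R. real (d r) * (c * x) ^ (t - 1) / real t ^ t) \<le> (\<Sum>r\<in>R. real (d r choose t))"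
    by (rule sum_mono)
  then have lower: "(\<Sum>r\<in>R. real (d r)) * ((c * x) ^ (t - 1) / real t ^ t) \<le> (\<Sum>r\<in>R. real (d r choose t))"
    by (simp add: sum_distrib_right sum_divide_distrib)
  \<comment> \<open>Rows outside \<open>R\<close> carry at most half of the guaranteed
    weight.\<close>
  have "(\<Sum>r<n. real (d r)) \<le> (\<Sum>r<n. (if r \<in> R then real (d r) else 0) + c * x)"
    using c xpos by (intro sum_mono) (auto simp: R_def)
  also have "\<dots> = (\<Sum>r\<in>R. real (d r)) + real n * (c * x)"
    using R(1) by (simp add: sum.distrib sum.If_cases Int_absorb1)
  finally have big: "c * real n * x < (\<Sum>r\<in>R. real (d r))"
    using heavy by (simp add: d_def algebra_simps)
  have fpos: "(c * x) ^ (t - 1) / real t ^ t > 0" using c xpos t by simp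
  have "2 * real B * real n ^ t \<le> (c / real t) ^ t * real n ^ t"
    using c by (intro mult_right_mono) auto
  also have "\<dots> = real n * (c * x) ^ t / real t ^ t"
    by (simp add: xt[symmetric] power_divide power_mult_distrib)
  also have "(c * x) ^ t = (c * x) * (c * x) ^ (t - 1)" using t by (cases t) auto
  also have "real n * ((c * x) * (c * x) ^ (t - 1)) / real t ^ t = c * real n * x * ((c * x) ^ (t - 1) / real t ^ t)"
    by simp
  also have "\<dots> < (\<Sum>r\<in>R. real (d r)) * ((c * x) ^ (t - 1) / real t ^ t)"
    using big fpos by (rule mult_strict_right_mono)
  finally show False using upper lower by linarith
qed

section \<open>Row intervals common to all transversals\<close>

text \<open>\<open>N r\<close> stands for the columns of the ones in row \<open>r\<close>. The
  elements of \<open>Q\<close> name \<open>m\<close> disjoint intervals of rows, each being the rows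
  with a given quotient by \<open>w\<close>. Which row of an interval realises a transversal may
  depend on the transversal.\<close>

lemma exists_common_intervals:
  fixes t k m :: nat
  assumes t: "t \<ge> 2" and k: "k \<ge> 1"
  obtains C n0 where "C > 0"
    and "\<And>n N. n \<ge> n0 \<Longrightarrow> (\<And>r. r < n \<Longrightarrow> N r \<subseteq> {..<n}) \<Longrightarrow>
           C * real n powr (2 - 1 / real t) < (\<Sum>r<n. real (card (N r))) \<Longrightarrow>
           \<exists>w Us Q. length Us = t \<and> (\<forall>U\<in>set Us. U \<subseteq> {..<n} \<and> card U = k) \<and> finite Q \<and> card Q = m \<and>
             (\<forall>T. list_all2 (\<in>) T Us \<longrightarrow> sorted_wrt (<) T \<and> (\<forall>q\<in>Q. \<exists>s<n. s div w = q \<and> set T \<subseteq> N s))"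
proof -
  obtain \<gamma> d0 where \<gamma>: "\<gamma> > 0" "\<gamma> \<le> 1"
    and box: "\<And>(X :: nat set) E. finite X \<Longrightarrow> d0 \<le> card X \<Longrightarrow>
           E \<subseteq> {xs. length xs = t \<and> set xs \<subseteq> X} \<Longrightarrow>
           real (card X) powr (real t - \<gamma>) \<le> real (card E) \<Longrightarrow>
           (\<exists>Us. length Us = t \<and> (\<forall>U\<in>set Us. U \<subseteq> X \<and> card U = k) \<and> {xs. list_all2 (\<in>) xs Us} \<subseteq> E)"
    using exists_box[OF k, of t, where 'a = nat] by meson
  \<comment> \<open>Depth for which \<open>p ^ m\<close>, about \<open>n powr (m / h)\<close>, is at
    most of order \<open>n powr (\<gamma> / 4)\<close>; the added 1 keeps \<open>h\<close> positive
    when \<open>m = 0\<close>.\<close>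
  define h where "h = nat \<lceil>4 * real m / \<gamma>\<rceil> + 1"
  have h: "h \<ge> 1" by (simp add: h_def)
  have hm: "real m / real h \<le> \<gamma> / 4"
  proof -
    have "4 * real m / \<gamma> \<le> real h" unfolding h_def by linarith
    then show ?thesis using \<gamma> h by (simp add: field_simps)
  qed
  define B where "B = m ^ h"
  \<comment> \<open>Chosen to give both \<open>c \<ge> 1\<close> and the condition
    \<open>2 * B \<le> (c / t) ^ t\<close> of \<open>exists_rich_row\<close>.\<close>
  define c where "c = real t * (2 * real B + 1)"
  have c1: "c \<ge> 1"
  proof -
    have "1 * 1 \<le> real t * (2 * real B + 1)" using t by (intro mult_mono) auto
    then show ?thesis by (simp add: c_def)
  qed
  have cB: "2 * real B \<le> (c / real t) ^ t"
  proof -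
    have "2 * real B + 1 \<le> (2 * real B + 1) ^ t" using t by (intro self_le_power) auto
    then show ?thesis using t by (simp add: c_def)
  qed
  \<comment> \<open>Collects the constants: \<open>t ^ t\<close> from the binomial, 2 for the good
    half, \<open>h\<close> levels, and \<open>2 ^ m\<close> from rounding \<open>p\<close>.\<close>
  define K where "K = 2 * real t ^ t * real h * 2 ^ m"
  have "eventually (\<lambda>d. K < real d powr (\<gamma> / 2)) at_top"
    using \<gamma>(1) by real_asymp
  then obtain d1 where d1: "\<And>d. d \<ge> d1 \<Longrightarrow> K < real d powr (\<gamma> / 2)"
    by (auto simp: eventually_at_top_linorder)
  define D where "D = max (max d0 d1) t"
  have "1 - 1 / real t > 0" using t by (simp add: field_simps)
  then have "eventually (\<lambda>n. real D \<le> real n powr (1 - 1 / real t)) at_top"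
    by real_asymp
  then have "eventually (\<lambda>n. real D \<le> real n powr (1 - 1 / real t) \<and> n \<ge> 1) at_top"
    using eventually_ge_at_top[of 1] by eventually_elim auto
  then obtain n0 where n0: "\<And>n. n \<ge> n0 \<Longrightarrow> real D \<le> real n powr (1 - 1 / real t) \<and> n \<ge> 1"
    by (auto simp: eventually_at_top_linorder)
  show thesis
  proof (rule that[of "2 * c" n0])
    show "2 * c > 0" using c1 by simp
    fix n :: nat and N :: "nat \<Rightarrow> nat set"
    assume n: "n \<ge> n0" and N: "\<And>r. r < n \<Longrightarrow> N r \<subseteq> {..<n}"
      and heavy: "2 * c * real n powr (2 - 1 / real t) < (\<Sum>r<n. real (card (N r)))"
    define x where "x = real n powr (1 - 1 / real t)"
    have n1: "n \<ge> 1" and xD: "real D \<le> x" using n0[OF n] by (auto simp: x_def)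
    have x0: "x \<ge> 0" by (simp add: x_def)
    have xcx: "x \<le> c * x" using mult_right_mono[OF c1 x0] by simp
    have "real n powr (2 - 1 / real t) = real n powr (1 + (1 - 1 / real t))" by (simp add: algebra_simps)
    also have "\<dots> = real n * x" unfolding powr_add x_def using n1 by simp
    finally have heavy': "2 * c * real n * x < (\<Sum>r<n. real (card (N r)))"
      using heavy by simp
    \<comment> \<open>Rounding up gives \<open>n \<le> p ^ h\<close>, so all rows lie below the
      single node 0 of level \<open>h\<close>.\<close>
    define p where "p = nat \<lceil>real n powr (1 / real h)\<rceil>"
    have p_ge: "real n powr (1 / real h) \<le> real p" unfolding p_def by linarith
    have p_le: "real p \<le> 2 * real n powr (1 / real h)"
    proof -
      have "1 \<le> real n powr (1 / real h)" using n1 by (intro ge_one_powr_ge_zero) auto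
      then show ?thesis unfolding p_def by linarith
    qed
    have p1: "p \<ge> 1"
    proof -
      have "0 < real n powr (1 / real h)" using n1 by simp
      then have "0 < real p" using p_ge by linarith
      then show ?thesis by simp
    qed
    have ph: "n \<le> p ^ h"
    proof -
      have "real n = (real n powr (1 / real h)) ^ h"
        using n1 h by (simp add: powr_realpow[symmetric] powr_powr)
      also have "\<dots> \<le> real p ^ h" using p_ge by (intro power_mono) auto
      finally show ?thesis by (simp flip: of_nat_power)
    qed
    define Occ where "Occ T = {s \<in> {..<n}. set T \<subseteq> N s}" for T
    define P where "P r T \<longleftrightarrow> (\<exists>l<h. m \<le> card (children p l (Occ T) r))" for r T
    have few: "card {r \<in> {..<n}. set T \<subseteq> N r \<and> \<not> P r T} \<le> B" for T
    proof -
      have "{r \<in> {..<n}. set T \<subseteq> N r \<and> \<not> P r T} = {r \<in> Occ T. \<forall>l<h. card (children p l (Occ T) r) < m}"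
        by (auto simp: P_def Occ_def not_le)
      also have "card \<dots> \<le> B" unfolding B_def
      proof (rule card_nonbranching_le)
        show "finite (Occ T)" by (simp add: Occ_def)
        show "s div p ^ h = 0" if "s \<in> Occ T" for s using that ph by (auto simp: Occ_def)
      qed
      finally show ?thesis .
    qed
    have cx: "real t \<le> c * x" using xD xcx by (simp add: D_def)
    have "\<exists>r<n. c * x \<le> real (card (N r)) \<and> card (N r) choose t \<le> 2 * card {T \<in> inc_lists t (N r). P r T}"
      by (rule exists_rich_row[where B = B]) (use t N x_def few heavy' c1 cB cx in auto)
    then obtain r where r: "r < n" "c * x \<le> real (card (N r))"
      "card (N r) choose t \<le> 2 * card {T \<in> inc_lists t (N r). P r T}" by blast
    define d where "d = card (N r)"
    have xd: "x \<le> real d" using r(2) xcx by (simp add: d_def)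
    then have dD: "D \<le> d" using xD by linarith
    then have d: "d \<ge> d0" "d \<ge> d1" "d \<ge> t" by (auto simp: D_def)
    have dpos: "real d > 0" using d t by simp
    have finN: "finite (N r)" using N[OF r(1)] finite_subset by blast
    \<comment> \<open>Here \<open>t \<ge> 2\<close> enters: \<open>d\<close> is at least the square
      root of \<open>n\<close>, so small powers of \<open>n\<close> are small powers of
      \<open>d\<close>.\<close>
    have nd: "real n \<le> real d powr 2"
    proof -
      have "real n powr (1/2) \<le> x" unfolding x_def using n1 t
        by (intro powr_mono) (auto simp: field_simps)
      then have "real n powr (1/2) \<le> real d" using xd by linarith
      then have "(real n powr (1/2)) powr 2 \<le> real d powr 2" by (intro powr_mono2) auto
      then show ?thesis using n1 by (simp add: powr_powr)
    qed
    define G where "G = {T \<in> inc_lists t (N r). P r T}"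
    have finG: "finite G" using finite_inc_lists[OF finN] by (simp add: G_def)
    \<comment> \<open>The \<open>p\<close> possible children of the level \<open>l + 1\<close>
      ancestor of \<open>r\<close>; choosing \<open>Q\<close> among them keeps the number of colours
      at most \<open>h * p ^ m\<close>.\<close>
    define J where "J l = {(r div p ^ Suc l) * p..<(r div p ^ Suc l) * p + p}" for l
    define Col where "Col = Sigma {..<h} (\<lambda>l. {Q. Q \<subseteq> J l \<and> card Q = m})"
    have finCol: "finite Col" by (auto simp: Col_def J_def)
    have "card Col = h * (p choose m)" by (simp add: Col_def J_def n_subsets)
    also have "p choose m \<le> p ^ m" by (cases "m \<le> p") (auto simp: binomial_le_pow binomial_eq_0)
    finally have cCol: "card Col \<le> h * p ^ m" by simp
    define E where "E = (\<lambda>(l, Q). {T \<in> G. Q \<subseteq> children p l (Occ T) r})"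
    have cover: "G \<subseteq> (\<Union>\<kappa>\<in>Col. E \<kappa>)"
    proof
      fix T assume T: "T \<in> G"
      then obtain l where l: "l < h" "m \<le> card (children p l (Occ T) r)" by (auto simp: G_def P_def)
      then obtain Q where Q: "Q \<subseteq> children p l (Occ T) r" "card Q = m"
        by (metis obtain_subset_with_card_n)
      have "children p l (Occ T) r \<subseteq> J l"
      proof
        fix q assume "q \<in> children p l (Occ T) r"
        then obtain s where s: "s div p ^ Suc l = r div p ^ Suc l" "q = s div p ^ l"
          unfolding children_def by blast
        have v: "r div p ^ Suc l = q div p" using s by (simp add: div_mult2_eq[symmetric] mult.commute)
        show "q \<in> J l" unfolding J_def v atLeastLessThan_iff
          using div_mult_mod_eq[of q p] mod_less_divisor[of p q] p1 by linarith
      qed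
      then have "(l, Q) \<in> Col" using l Q by (auto simp: Col_def)
      moreover have "T \<in> E (l, Q)" using T Q by (simp add: E_def)
      ultimately show "T \<in> (\<Union>\<kappa>\<in>Col. E \<kappa>)" by blast
    qed
    have finE: "finite (E \<kappa>)" for \<kappa> using finG by (auto simp: E_def split: prod.splits)
    define y where "y = real d powr (real t - \<gamma>)"
    \<comment> \<open>Otherwise \<open>G\<close>, at least half of the \<open>t\<close>-sets, would
      be covered by at most \<open>h * p ^ m\<close> classes of size at most
      \<open>d powr (t - \<gamma>)\<close>; as \<open>p ^ m\<close> is at most of order
      \<open>d powr (\<gamma> / 2)\<close>, this is too little for large \<open>d\<close>.\<close>
    have "\<exists>\<kappa>\<in>Col. y \<le> real (card (E \<kappa>))"
    proof (rule ccontr)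
      assume "\<not> ?thesis"
      then have small: "\<And>\<kappa>. \<kappa> \<in> Col \<Longrightarrow> real (card (E \<kappa>)) \<le> y" by force
      have ypos: "y > 0" using dpos by (simp add: y_def)
      have "card G \<le> card (\<Union>\<kappa>\<in>Col. E \<kappa>)" using finCol finE cover by (intro card_mono) auto
      also have "\<dots> \<le> (\<Sum>\<kappa>\<in>Col. card (E \<kappa>))" by (rule card_UN_le[OF finCol])
      finally have "real (card G) \<le> (\<Sum>\<kappa>\<in>Col. real (card (E \<kappa>)))"
        by (metis of_nat_le_iff of_nat_sum)
      also have "\<dots> \<le> real (card Col) * y"
        using sum_bounded_above[of Col "\<lambda>\<kappa>. real (card (E \<kappa>))" y] small by simp
      also have "\<dots> \<le> real (h * p ^ m) * y"
        using cCol ypos by (intro mult_right_mono of_nat_mono) auto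
      finally have G1: "real (card G) \<le> real h * real p ^ m * y" by simp
      have "real p ^ m \<le> (2 * real n powr (1 / real h)) ^ m" using p_le by (intro power_mono) auto
      also have "\<dots> = 2 ^ m * real n powr (real m / real h)"
        using n1 by (simp add: power_mult_distrib powr_realpow[symmetric] powr_powr)
      also have "\<dots> \<le> 2 ^ m * real n powr (\<gamma> / 4)"
        using hm n1 by (intro mult_left_mono powr_mono) auto
      also have "\<dots> \<le> 2 ^ m * (real d powr 2) powr (\<gamma> / 4)"
        using nd \<gamma> by (intro mult_left_mono powr_mono2) auto
      also have "\<dots> = 2 ^ m * real d powr (\<gamma> / 2)" unfolding powr_powr by simp
      finally have pm: "real p ^ m \<le> 2 ^ m * real d powr (\<gamma> / 2)" .
      have "(real d / real t) ^ t \<le> real (d choose t)" by (rule binomial_ge_n_over_k_pow_k[OF d(3)])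
      also have "\<dots> \<le> real (2 * card G)" using r(3) unfolding d_def G_def by (rule of_nat_mono)
      finally have "(real d / real t) ^ t \<le> 2 * (real h * real p ^ m * y)" using G1 by simp
      also have "\<dots> \<le> 2 * (real h * (2 ^ m * real d powr (\<gamma> / 2)) * y)"
        using pm ypos by (intro mult_left_mono mult_right_mono) auto
      finally have "real d ^ t \<le> real t ^ t * (2 * (real h * (2 ^ m * real d powr (\<gamma> / 2)) * y))"
        using t by (simp add: power_divide field_simps)
      also have "\<dots> = K * (real d powr (\<gamma> / 2) * y)"
        by (simp add: K_def)
      also have "real d powr (\<gamma> / 2) * y = real d powr (real t - \<gamma> / 2)"
        by (simp add: y_def powr_add[symmetric] field_simps)
      finally have "real d powr (\<gamma> / 2) * real d powr (real t - \<gamma> / 2) \<le> K * real d powr (real t - \<gamma> / 2)"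
        using dpos by (simp add: powr_add[symmetric] powr_realpow)
      with dpos have "real d powr (\<gamma> / 2) \<le> K" by simp
      with d1[OF d(2)] show False by linarith
    qed
    then obtain l Q where lQ: "l < h" "Q \<subseteq> J l" "card Q = m" "y \<le> real (card (E (l, Q)))"
      by (auto simp: Col_def)
    have "E (l, Q) \<subseteq> {xs. length xs = t \<and> set xs \<subseteq> N r}"
      by (auto simp: E_def G_def inc_lists_def)
    from box[OF finN _ this] lQ(4) d(1) obtain Us where Us: "length Us = t" "\<forall>U\<in>set Us. U \<subseteq> N r \<and> card U = k"
      "{xs. list_all2 (\<in>) xs Us} \<subseteq> E (l, Q)"
      by (auto simp: d_def y_def)
    show "\<exists>w Us Q. length Us = t \<and> (\<forall>U\<in>set Us. U \<subseteq> {..<n} \<and> card U = k) \<and> finite Q \<and> card Q = m \<and>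
             (\<forall>T. list_all2 (\<in>) T Us \<longrightarrow> sorted_wrt (<) T \<and> (\<forall>q\<in>Q. \<exists>s<n. s div w = q \<and> set T \<subseteq> N s))"
    \<comment> \<open>The width is \<open>w = p ^ l\<close>: the intervals are the leaf sets of the
      nodes in \<open>Q\<close>, and each of these nodes has a descendant in
      \<open>Occ T\<close>.\<close>
    proof (intro exI conjI allI impI)
      show "\<forall>U\<in>set Us. U \<subseteq> {..<n} \<and> card U = k" using Us(2) N[OF r(1)] by blast
      show "finite Q" using lQ(2) by (rule finite_subset) (simp add: J_def)
      fix T assume "list_all2 (\<in>) T Us"
      then have T: "T \<in> E (l, Q)" using Us(3) by blast
      then show "sorted_wrt (<) T" by (simp add: E_def G_def inc_lists_def)
      from T have "Q \<subseteq> children p l (Occ T) r" by (simp add: E_def)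
      then have "Q \<subseteq> (\<lambda>s. s div p ^ l) ` Occ T" unfolding children_def by blast
      then show "\<forall>q\<in>Q. \<exists>s<n. s div p ^ l = q \<and> set T \<subseteq> N s"
        unfolding Occ_def by blast
    qed (fact Us(1) lQ(3))+
  qed
qed

section \<open>Embedding the pattern\<close>

text \<open>A submatrix entry is addressed by the number of kept indices below it; this evaluates
  that number when the kept indices are the range of an increasing map.\<close>

lemma card_less_image_strict_mono_on:
  fixes f :: "nat \<Rightarrow> nat"
  assumes "strict_mono_on {..<m} f" "i < m"
  shows "card {a \<in> f ` {..<m}. a < f i} = i"
proof -
  have inj: "inj_on f {..<m}" by (rule strict_mono_on_imp_inj_on[OF assms(1)])
  have "{a \<in> f ` {..<m}. a < f i} = f ` {..<i}"
    using assms by (auto simp: strict_mono_on_less)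
  moreover have "inj_on f {..<i}" using inj by (rule inj_on_subset) (use assms in auto)
  ultimately show ?thesis by (simp add: card_image)
qed

text \<open>Replaces the kept index sets by increasing maps. Only the ones of \<open>A\<close> need
  checking, since its other entries are 0.\<close>

lemma mat_containsI:
  assumes A: "zero_one_mat A"
    and f: "strict_mono_on {..<dim_row A} f" "f ` {..<dim_row A} \<subseteq> {..<dim_row M}"
    and g: "strict_mono_on {..<dim_col A} g" "g ` {..<dim_col A} \<subseteq> {..<dim_col M}"
    and one: "\<And>i j. i < dim_row A \<Longrightarrow> j < dim_col A \<Longrightarrow> A $$ (i, j) = 1 \<Longrightarrow> M $$ (f i, g j) = 1"
  shows "mat_contains M A"
proof -
  define I where "I = f ` {..<dim_row A}"
  define J where "J = g ` {..<dim_col A}"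
  have sets: "{i. i < dim_row M \<and> i \<in> I} = I" "{j. j < dim_col M \<and> j \<in> J} = J"
    using f g by (auto simp: I_def J_def)
  have card: "card I = dim_row A" "card J = dim_col A"
    using strict_mono_on_imp_inj_on[OF f(1)] strict_mono_on_imp_inj_on[OF g(1)]
    by (auto simp: I_def J_def card_image)
  have "A \<le> submatrix M I J"
    unfolding less_eq_mat_def dim_submatrix sets card
  proof (intro conjI allI impI refl)
    fix i j assume ij: "i < dim_row A" "j < dim_col A"
    have "submatrix M I J $$ (card {a \<in> I. a < f i}, card {a \<in> J. a < g j}) = M $$ (f i, g j)"
      using f g ij by (intro submatrix_index_card) (auto simp: I_def J_def)
    then have eq: "submatrix M I J $$ (i, j) = M $$ (f i, g j)"
      using card_less_image_strict_mono_on[OF f(1) ij(1)] card_less_image_strict_mono_on[OF g(1) ij(2)]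
      by (simp add: I_def J_def)
    have "A $$ (i, j) \<in> {0, 1}" using A ij elements_matI[of A "dim_row A" "dim_col A" i j]
      by (auto simp: zero_one_mat_def)
    then show "A $$ (i, j) \<le> submatrix M I J $$ (i, j)" using one[OF ij] eq by auto
  qed
  then show ?thesis unfolding mat_contains_def using f g by (intro exI[of _ I] exI[of _ J]) (auto simp: I_def J_def)
qed

text \<open>Moves the condition on the pieces to the columns of \<open>A\<close> itself: column
  \<open>l\<close> has position \<open>l - c \<kappa>\<close> in piece
  \<open>\<kappa>\<close>.\<close>

lemma column_partite_unique:
  assumes "column_partite t A"
  obtains c where "c 0 = 0" "c t = dim_col A" "mono_on {..t} c"
    "\<And>\<kappa> i j j'. \<kappa> < t \<Longrightarrow> i < dim_row A \<Longrightarrow> j \<in> {c \<kappa>..<c (Suc \<kappa>)} \<Longrightarrow> j' \<in> {c \<kappa>..<c (Suc \<kappa>)} \<Longrightarrow>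
       A $$ (i, j) = 1 \<Longrightarrow> A $$ (i, j') = 1 \<Longrightarrow> j = j'"
proof -
  obtain c where c: "c 0 = 0" "c t = dim_col A" "mono_on {..t} c"
    and one: "\<And>\<kappa> i. \<kappa> < t \<Longrightarrow> i < dim_row (submatrix A UNIV {c \<kappa>..<c (Suc \<kappa>)}) \<Longrightarrow>
      card {j. j < dim_col (submatrix A UNIV {c \<kappa>..<c (Suc \<kappa>)}) \<and> submatrix A UNIV {c \<kappa>..<c (Suc \<kappa>)} $$ (i, j) = 1} \<le> 1"
    using assms unfolding column_partite_def Let_def by blast
  show thesis
  proof (rule that[OF c])
    fix \<kappa> i j j' assume *: "\<kappa> < t" "i < dim_row A" "j \<in> {c \<kappa>..<c (Suc \<kappa>)}" "j' \<in> {c \<kappa>..<c (Suc \<kappa>)}"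
      "A $$ (i, j) = 1" "A $$ (i, j') = 1"
    define S where "S = {c \<kappa>..<c (Suc \<kappa>)}"
    define B where "B = submatrix A UNIV S"
    have le: "c (Suc \<kappa>) \<le> dim_col A" using mono_onD[OF c(3), of "Suc \<kappa>" t] *(1) c(2) by simp
    have "{j. j < dim_col A \<and> j \<in> S} = S" using le by (auto simp: S_def)
    then have dim: "dim_row B = dim_row A" "dim_col B = c (Suc \<kappa>) - c \<kappa>"
      by (simp_all add: B_def dim_submatrix) (simp add: S_def)
    have entry: "B $$ (i, l - c \<kappa>) = A $$ (i, l)" if "l \<in> S" for l
    proof -
      have "{a \<in> S. a < l} = {c \<kappa>..<l}" using that by (auto simp: S_def)
      moreover have "{a \<in> UNIV. a < i} = {..<i}" by auto
      ultimately show ?thesis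
        using submatrix_index_card[of i A l UNIV S] *(2) that le by (auto simp: B_def S_def)
    qed
    define Ones where "Ones = {j. j < dim_col B \<and> B $$ (i, j) = 1}"
    have "card Ones \<le> 1" using one[OF *(1), of i] *(2) dim by (simp add: Ones_def B_def S_def)
    moreover have "finite Ones" by (simp add: Ones_def)
    moreover have "j - c \<kappa> \<in> Ones" "j' - c \<kappa> \<in> Ones"
      using * entry[of j] entry[of j'] dim by (auto simp: Ones_def S_def)
    ultimately have "j - c \<kappa> = j' - c \<kappa>" by (auto simp: card_le_Suc0_iff_eq)
    then show "j = j'" using * by auto
  qed
qed

lemma exists_piece:
  fixes c :: "nat \<Rightarrow> nat"
  assumes "c 0 = 0" "j < c t"
  shows "\<exists>\<kappa><t. c \<kappa> \<le> j \<and> j < c (Suc \<kappa>)"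
  using assms(2)
proof (induction t)
  case (Suc t)
  then show ?case by (cases "j < c t") (auto intro: less_SucI)
qed (use assms in simp)

text \<open>Piece \<open>\<kappa>\<close> of the columns is mapped in order into
  \<open>Us ! \<kappa>\<close>. A row of \<open>A\<close> has at most one 1 per piece, so its ones
  land in a single transversal, and every interval has a row with ones there. Different rows of
  \<open>A\<close> use different intervals, so their choices do not interfere. The extra element in
  \<open>Suc (dim_col A)\<close> keeps the parts nonempty.\<close>

lemma mat_contains_if_common_intervals:
  fixes Us :: "nat set list" and Q :: "nat set"
  assumes A: "zero_one_mat A" "column_partite t A"
    and M: "M \<in> carrier_mat n n"
    and Us: "length Us = t" "\<And>U. U \<in> set Us \<Longrightarrow> U \<subseteq> {..<n} \<and> card U = Suc (dim_col A)"
    and Q: "finite Q" "card Q = dim_row A"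
    and sorted: "\<And>T. list_all2 (\<in>) T Us \<Longrightarrow> sorted_wrt (<) T"
    and hit: "\<And>T q. list_all2 (\<in>) T Us \<Longrightarrow> q \<in> Q \<Longrightarrow> \<exists>s<n. s div w = q \<and> (\<forall>u\<in>set T. M $$ (s, u) = 1)"
  shows "mat_contains M A"
proof -
  obtain c where c: "c 0 = 0" "c t = dim_col A" "mono_on {..t} c"
    and unique: "\<And>\<kappa> i j j'. \<kappa> < t \<Longrightarrow> i < dim_row A \<Longrightarrow> j \<in> {c \<kappa>..<c (Suc \<kappa>)} \<Longrightarrow> j' \<in> {c \<kappa>..<c (Suc \<kappa>)} \<Longrightarrow>
       A $$ (i, j) = 1 \<Longrightarrow> A $$ (i, j') = 1 \<Longrightarrow> j = j'"
    using column_partite_unique[OF A(2)] by blast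
  define L where "L \<kappa> = sorted_list_of_set (Us ! \<kappa>)" for \<kappa>
  have U: "Us ! \<kappa> \<subseteq> {..<n}" "card (Us ! \<kappa>) = Suc (dim_col A)" "finite (Us ! \<kappa>)" if "\<kappa> < t" for \<kappa>
    using Us that by (auto intro: nth_mem card_ge_0_finite)
  have L: "set (L \<kappa>) = Us ! \<kappa>" "length (L \<kappa>) = Suc (dim_col A)" "sorted_wrt (<) (L \<kappa>)" if "\<kappa> < t" for \<kappa>
    using U[OF that] by (auto simp: L_def)
  have L0: "L \<kappa> ! 0 \<in> Us ! \<kappa>" if "\<kappa> < t" for \<kappa>
    using L[OF that] nth_mem[of 0 "L \<kappa>"] by simp
  \<comment> \<open>Two elements of different parts extend to a transversal, with first elements as
    filler, and transversals are increasing; hence the parts follow each other.\<close>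
  have less: "u < v" if "\<kappa> < \<kappa>'" "\<kappa>' < t" "u \<in> Us ! \<kappa>" "v \<in> Us ! \<kappa>'" for \<kappa> \<kappa>' u v
  proof -
    define T where "T = map (\<lambda>i. if i = \<kappa> then u else if i = \<kappa>' then v else L i ! 0) [0..<t]"
    have "list_all2 (\<in>) T Us"
      unfolding list_all2_conv_all_nth T_def using that Us(1) L0 by simp
    then have "sorted_wrt (<) T" by (rule sorted)
    moreover have "length T = t" by (simp add: T_def)
    ultimately have "T ! \<kappa> < T ! \<kappa>'" using that(1,2) by (simp add: sorted_wrt_iff_nth_less)
    moreover have "T ! \<kappa> = u" "T ! \<kappa>' = v" using that(1,2) by (simp_all add: T_def)
    ultimately show ?thesis by simp
  qed
  define pc where "pc j = (SOME \<kappa>. \<kappa> < t \<and> c \<kappa> \<le> j \<and> j < c (Suc \<kappa>))" for j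
  have pc: "pc j < t" "c (pc j) \<le> j" "j < c (Suc (pc j))" if "j < dim_col A" for j
    using someI_ex[OF exists_piece[of c j t]] that c(1,2) unfolding pc_def by auto
  define g where "g j = L (pc j) ! (j - c (pc j))" for j
  have g_in: "g j \<in> Us ! pc j" if "j < dim_col A" for j
    using pc[OF that] L[of "pc j"] that nth_mem[of "j - c (pc j)" "L (pc j)"] by (simp add: g_def)
  have g_mono: "g j < g j'" if j: "j < j'" "j' < dim_col A" for j j'
  proof -
    have jj: "j < dim_col A" using j by simp
    consider "pc j < pc j'" | "pc j = pc j'" | "pc j' < pc j" by linarith
    then show ?thesis
    proof cases
      case 1
      then show ?thesis using less g_in jj j(2) pc(1)[OF j(2)] by blast
    next
      case 2
      define a where "a = j - c (pc j)"
      define b where "b = j' - c (pc j)"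
      have "a < b" "b < length (L (pc j))"
        using 2 pc[OF jj] pc[OF j(2)] L(2)[of "pc j"] j by (auto simp: a_def b_def)
      then have "L (pc j) ! a < L (pc j) ! b"
        using L(3)[OF pc(1)[OF jj]] by (simp add: sorted_wrt_iff_nth_less)
      then show ?thesis using 2 by (simp add: g_def a_def b_def)
    next
      case 3
      then have "c (Suc (pc j')) \<le> c (pc j)" using mono_onD[OF c(3), of "Suc (pc j')" "pc j"] pc(1)[OF jj] by simp
      then show ?thesis using pc[OF jj] pc[OF j(2)] j by linarith
    qed
  qed
  \<comment> \<open>The transversal for row \<open>i\<close>: the image of its 1 in each piece, and
    a filler where the piece has none.\<close>
  define T where "T i = map (\<lambda>\<kappa>. if \<exists>j\<in>{c \<kappa>..<c (Suc \<kappa>)}. A $$ (i, j) = 1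
      then g (SOME j. j \<in> {c \<kappa>..<c (Suc \<kappa>)} \<and> A $$ (i, j) = 1) else L \<kappa> ! 0) [0..<t]" for i
  \<comment> \<open>Monotonicity of \<open>c\<close> makes the pieces disjoint, so the choice in
    \<open>pc\<close> is forced even when some pieces are empty.\<close>
  have piece_unique: "pc j = \<kappa>" if "\<kappa> < t" "c \<kappa> \<le> j" "j < c (Suc \<kappa>)" for j \<kappa>
  proof -
    have "c (Suc \<kappa>) \<le> c t" using that(1) by (intro mono_onD[OF c(3)]) auto
    then have j: "j < dim_col A" using that c(2) by simp
    have "\<not> pc j < \<kappa>" using mono_onD[OF c(3), of "Suc (pc j)" \<kappa>] pc[OF j] that by auto
    moreover have "\<not> \<kappa> < pc j" using mono_onD[OF c(3), of "Suc \<kappa>" "pc j"] pc[OF j] that by auto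
    ultimately show ?thesis by simp
  qed
  have T: "list_all2 (\<in>) (T i) Us" for i
    unfolding list_all2_conv_all_nth
  proof (intro conjI allI impI)
    show "length (T i) = length Us" by (simp add: T_def Us(1))
    fix \<kappa> assume "\<kappa> < length (T i)"
    then have \<kappa>: "\<kappa> < t" by (simp add: T_def)
    show "T i ! \<kappa> \<in> Us ! \<kappa>"
    proof (cases "\<exists>j\<in>{c \<kappa>..<c (Suc \<kappa>)}. A $$ (i, j) = 1")
      case True
      define j where "j = (SOME j. j \<in> {c \<kappa>..<c (Suc \<kappa>)} \<and> A $$ (i, j) = 1)"
      have "j \<in> {c \<kappa>..<c (Suc \<kappa>)}" unfolding j_def using True by (metis (mono_tags, lifting) someI_ex)
      moreover from this have "pc j = \<kappa>" using piece_unique[OF \<kappa>] by simp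
      moreover have "c (Suc \<kappa>) \<le> c t" using \<kappa> by (intro mono_onD[OF c(3)]) auto
      ultimately have "g j \<in> Us ! \<kappa>" using g_in[of j] c(2) by simp
      then show ?thesis using True \<kappa> by (simp add: T_def j_def)
    next
      case False
      then show ?thesis using \<kappa> L0 by (auto simp: T_def)
    qed
  qed
  have g_T: "g j \<in> set (T i)" if "i < dim_row A" "j < dim_col A" "A $$ (i, j) = 1" for i j
  proof -
    have j: "j \<in> {c (pc j)..<c (Suc (pc j))}" using pc[OF that(2)] by simp
    have "(SOME l. l \<in> {c (pc j)..<c (Suc (pc j))} \<and> A $$ (i, l) = 1) = j"
      by (rule some_equality) (use j that unique[OF pc(1)[OF that(2)] that(1)] in blast)+
    moreover have "\<exists>l\<in>{c (pc j)..<c (Suc (pc j))}. A $$ (i, l) = 1" using j that by blast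
    ultimately have "T i ! pc j = g j" using pc(1)[OF that(2)] by (simp add: T_def)
    then show ?thesis using pc(1)[OF that(2)] nth_mem[of "pc j" "T i"] by (simp add: T_def)
  qed
  define q where "q i = sorted_list_of_set Q ! i" for i
  have q_in: "q i \<in> Q" if "i < dim_row A" for i
    using that Q nth_mem[of i "sorted_list_of_set Q"] by (simp add: q_def)
  have q_mono: "q i < q i'" if "i < i'" "i' < dim_row A" for i i'
    unfolding q_def using that Q by (intro sorted_wrt_nth_less[of "(<)" "sorted_list_of_set Q"]) auto
  have "\<forall>i\<in>{..<dim_row A}. \<exists>s<n. s div w = q i \<and> (\<forall>u\<in>set (T i). M $$ (s, u) = 1)"
    using hit[OF T q_in] by blast
  then obtain f where f: "\<And>i. i < dim_row A \<Longrightarrow> f i < n \<and> f i div w = q i \<and> (\<forall>u\<in>set (T i). M $$ (f i, u) = 1)"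
    by (metis lessThan_iff)
  show ?thesis
  proof (rule mat_containsI[OF A(1), of f M g])
    show "strict_mono_on {..<dim_row A} f"
    proof (rule strict_mono_onI)
      fix i i' assume "i \<in> {..<dim_row A}" "i' \<in> {..<dim_row A}" "i < i'"
      \<comment> \<open>Increasing quotients order the rows, whichever row was chosen in each
        interval.\<close>
      then have "f i div w < f i' div w" using f q_mono by simp
      then show "f i < f i'" by (meson div_le_mono not_le)
    qed
    show "strict_mono_on {..<dim_col A} g" using g_mono by (auto intro: strict_mono_onI)
    show "g ` {..<dim_col A} \<subseteq> {..<dim_col M}" using g_in U(1) pc(1) M by fastforce
    show "f ` {..<dim_row A} \<subseteq> {..<dim_row M}" using f M by auto
    show "M $$ (f i, g j) = 1" if "i < dim_row A" "j < dim_col A" "A $$ (i, j) = 1" for i j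
      using f g_T that by blast
  qed
qed

section \<open>From the weight bound to the extremal number\<close>

lemma mat_weight_eq_sum:
  "real (mat_weight M) = (\<Sum>r<dim_row M. real (card {j. j < dim_col M \<and> M $$ (r, j) = 1}))"
proof -
  have "{(i, j). i < dim_row M \<and> j < dim_col M \<and> M $$ (i, j) = 1} =
      Sigma {..<dim_row M} (\<lambda>r. {j. j < dim_col M \<and> M $$ (r, j) = 1})" by auto
  then show ?thesis by (simp add: mat_weight_def)
qed

theorem theorem1p5:
  fixes t :: nat and A :: "nat mat"
  assumes "t \<ge> 2"
    and "zero_one_mat A"
    and "column_partite t A"
  shows "(\<lambda>n. real (mat_ex n A)) \<in> O(\<lambda>n. real n powr (2 - 1 / real t))"
proof -
  have "Suc (dim_col A) \<ge> 1" by simp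
  from exists_common_intervals[OF assms(1) this, where m = "dim_row A"]
  obtain C n0 where C: "C > 0"
    and common: "\<And>n N. n \<ge> n0 \<Longrightarrow> (\<And>r. r < n \<Longrightarrow> N r \<subseteq> {..<n}) \<Longrightarrow>
           C * real n powr (2 - 1 / real t) < (\<Sum>r<n. real (card (N r))) \<Longrightarrow>
           \<exists>w Us Q. length Us = t \<and> (\<forall>U\<in>set Us. U \<subseteq> {..<n} \<and> card U = Suc (dim_col A)) \<and>
             finite Q \<and> card Q = dim_row A \<and>
             (\<forall>T. list_all2 (\<in>) T Us \<longrightarrow> sorted_wrt (<) T \<and> (\<forall>q\<in>Q. \<exists>s<n. s div w = q \<and> set T \<subseteq> N s))"
    by blast
  have weight: "real (mat_weight M) \<le> C * real n powr (2 - 1 / real t)"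
    if n: "n \<ge> n0" and M: "M \<in> carrier_mat n n" "\<not> mat_contains M A" for n M
  proof (rule ccontr)
    assume "\<not> ?thesis"
    then have "C * real n powr (2 - 1 / real t) < (\<Sum>r<n. real (card {j. j < n \<and> M $$ (r, j) = 1}))"
      using mat_weight_eq_sum[of M] M(1) by auto
    moreover have "{j. j < n \<and> M $$ (r, j) = 1} \<subseteq> {..<n}" for r by blast
    ultimately have ex: "\<exists>w Us Q. length Us = t \<and> (\<forall>U\<in>set Us. U \<subseteq> {..<n} \<and> card U = Suc (dim_col A)) \<and>
             finite Q \<and> card Q = dim_row A \<and>
             (\<forall>T. list_all2 (\<in>) T Us \<longrightarrow> sorted_wrt (<) T \<and>
               (\<forall>q\<in>Q. \<exists>s<n. s div w = q \<and> set T \<subseteq> {j. j < n \<and> M $$ (s, j) = 1}))"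
      by (intro common n)
    from ex obtain w Us Q where Us: "length Us = t"
      "\<forall>U\<in>set Us. U \<subseteq> {..<n} \<and> card U = Suc (dim_col A)" and Q: "finite Q" "card Q = dim_row A"
      and T: "\<forall>T. list_all2 (\<in>) T Us \<longrightarrow> sorted_wrt (<) T \<and>
        (\<forall>q\<in>Q. \<exists>s<n. s div w = q \<and> set T \<subseteq> {j. j < n \<and> M $$ (s, j) = 1})"
      by (elim exE conjE) (rule that)
    have "\<exists>s<n. s div w = q \<and> (\<forall>u\<in>set T. M $$ (s, u) = 1)" if "list_all2 (\<in>) T Us" "q \<in> Q" for T q
      using T that by blast
    then have "mat_contains M A"
      using T Us(2) by (intro mat_contains_if_common_intervals[OF assms(2,3) M(1) Us(1) _ Q, of w]) blast+
    with M(2) show False by simp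
  qed
  have "real (mat_ex n A) \<le> C * real n powr (2 - 1 / real t)" if n: "n \<ge> n0" for n
  proof -
    define S where "S = mat_weight ` {M \<in> carrier_mat n n. zero_one_mat M \<and> \<not> mat_contains M A}"
    have S: "real s \<le> C * real n powr (2 - 1 / real t)" if "s \<in> S" for s
      using that weight[OF n] by (auto simp: S_def)
    \<comment> \<open>A natural number as bound also covers the empty set, whose \<open>Sup\<close>
      is 0.\<close>
    have "Sup S \<le> nat \<lfloor>C * real n powr (2 - 1 / real t)\<rfloor>"
    proof (cases "S = {}")
      case False
      then show ?thesis using S by (intro cSup_least) (auto intro: le_nat_floor)
    qed simp
    then have "real (Sup S) \<le> real (nat \<lfloor>C * real n powr (2 - 1 / real t)\<rfloor>)" by simp
    also have "\<dots> \<le> C * real n powr (2 - 1 / real t)" using C by simp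
    finally show ?thesis by (simp add: mat_ex_def S_def)
  qed
  then have "eventually (\<lambda>n. norm (real (mat_ex n A)) \<le> C * norm (real n powr (2 - 1 / real t))) at_top"
    by (intro eventually_at_top_linorderI[of n0]) auto
  then show ?thesis by (rule bigoI)
qed

end
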